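(* Let $\mathcal T$ and $\mathcal S$ be local approximation classes in $\mathbb{R}^n$ such that $\mathcal T$ points are $(\phi,\Phi)$ detectable in $\mathcal S$. Given $\delta\leq\phi/32$, $t\in(0,1)$ such that $\Phi(t)\leq\delta/4$, and $0\leq\varepsilon<t\delta/16$, let $$\mathcal P=(\mathcal S;\varepsilon)^\Theta_{0,\infty}\quad\text{and}\quad\mathcal Q=(\mathcal T;\delta)^\Theta_{0,\infty}.$$ If a nonempty set $A\subseteq\mathbb{R}^n$ is locally $\varepsilon$-approximable by $\mathcal S$, then $A$ can be written as a disjoint union $$A=A_{\mathcal Q}\cup A_{\mathcal Q^\perp},\qquad A_{\mathcal Q}\cap A_{\mathcal Q^\perp}=\emptyset,$$ where $\Psi\text{-}\mathrm{Tan}(\overline A,x)\subseteq\mathcal P\cap\mathcal Q$ for all $x\in A_{\mathcal Q}$ and $\mathrm{Tan}(\overline A,x)\subseteq\mathcal P\cap\mathcal Q^\perp$ for all $x\in A_{\mathcal Q^\perp}$. Moreover, $A_{\mathcal Q}$ is relatively open in $A$ and $A_{\mathcal Q}$ is locally $\delta$-approximable by $\mathcal T$.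
   Context: $B(x,r)$ denotes the closed ball in $\mathbb{R}^n$ and $\overline A$ the closure of $A$. $\mathfrak C(0)$ is the collection of closed subsets of $\mathbb{R}^n$ containing $0$. For $A,B\subseteq\mathbb{R}^n$ with $B\neq\emptyset$, $\mathrm{ex}(A,B)=\sup_{a\in A}\inf_{b\in B}|a-b|$, with $\mathrm{ex}(\emptyset,B)=0$. Nonempty closed sets $A_i$ converge to a nonempty closed set $A$ (Attouch--Wets topology), $A_i\to A$, if $\mathrm{ex}(A_i\cap B(0,r),A)\to0$ and $\mathrm{ex}(A\cap B(0,r),A_i)\to 0$ for all $r>0$. A local approximation class is a nonempty collection $\mathcal S\subseteq\mathfrak C(0)$ such that $\lambda S\in\mathcal S$ for all $S\in\mathcal S$, $\lambda>0$. For nonempty $A,B$ put $\widetilde{\mathrm D}^{x,r}[A,B]=\frac1r\max\{\mathrm{ex}(A\cap B(x,r),B),\mathrm{ex}(B\cap B(x,r),A)\}$, and $\Theta^{\mathcal S}_A(x,r)=\inf_{S\in\mathcal S}\widetilde{\mathrm D}^{x,r}[A,x+S]$. A set $A$ is locally $\varepsilon$-approximable by $\mathcal S$ if for every compact $K\subseteq A$ there is $r_K>0$ such that $\Theta^{\mathcal S}_A(x,r)\leq\varepsilon$ for all $x\in K$ and $0<r\leq r_K$ (vacuous for the empty set). Enlargements: for $\varepsilon\geq0$, $(\mathcal S;\varepsilon)^\Theta_{0,\infty}=\{D\in\mathfrak C(0):\Theta^{\mathcal S}_D(0,r)\leq\varepsilon\text{ for all }r>0\}$; this is again a local approximation class.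 For closed $A$ and $x\in A$, $\Psi\text{-}\mathrm{Tan}(A,x)$ is the collection of $T\in\mathfrak C(0)$ for which there exist $x_i\in A$, $r_i>0$ with $x_i\to x$, $r_i\to0$ and $(A-x_i)/r_i\to T$; $\mathrm{Tan}(A,x)$ is the subcollection of those $T$ for which one may take $x_i=x$ for all $i$. Singular class of a local approximation class $\mathcal Q$: $\mathcal Q^\perp=\{D\in\mathfrak C(0):\liminf_{r\downarrow0}\Theta^{\mathcal Q}_D(0,r)>0\}$. $\mathcal T$ points are $(\phi,\Phi)$ detectable in $\mathcal S$, where $\phi>0$ and $\Phi:(0,1)\to(0,\infty)$ satisfies $\liminf_{s\to0+}\Phi(s)=0$, if whenever $S\in\mathcal S$, $r>0$ and $\Theta^{\mathcal T}_S(0,r)<\phi$, then $\Theta^{\mathcal T}_S(0,sr)<\Phi(s)$ for all $s\in(0,1)$. *)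

theory Defs
  imports "HOL-Analysis.Analysis"
begin

text \<open>
  Excesses and the quantities derived from them take values in \<^typ>\<open>ennreal\<close>, where the
  supremum over the empty set is \<open>0\<close>, so that \<open>excess {} B = 0\<close>.  The value \<open>excess A {} = \<infinity>\<close>
  for \<open>A \<noteq> {}\<close> is a convention; the notions below only use nonempty second arguments.
\<close>

definition excess :: "'a::euclidean_space set \<Rightarrow> 'a set \<Rightarrow> ennreal" where
  "excess A B = (SUP a\<in>A. INF b\<in>B. ennreal (dist a b))"

definition closed_through_0 :: "'a::euclidean_space set set" where
  "closed_through_0 = {D. closed D \<and> 0 \<in> D}"

text \<open>Convergence of nonempty closed sets in the Attouch--Wets topology.\<close>

definition Attouch_Wets_lim :: "(nat \<Rightarrow> 'a::euclidean_space set) \<Rightarrow> 'a set \<Rightarrow> bool" where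
  "Attouch_Wets_lim X A \<longleftrightarrow>
    (\<forall>r>0. (\<lambda>i. excess (X i \<inter> cball 0 r) A) \<longlonglongrightarrow> 0 \<and>
           (\<lambda>i. excess (A \<inter> cball 0 r) (X i)) \<longlonglongrightarrow> 0)"

definition local_approx_class :: "'a::euclidean_space set set \<Rightarrow> bool" where
  "local_approx_class \<S> \<longleftrightarrow>
    \<S> \<noteq> {} \<and> \<S> \<subseteq> closed_through_0 \<and> (\<forall>S\<in>\<S>. \<forall>c>0. (\<lambda>y. c *\<^sub>R y) ` S \<in> \<S>)"

text \<open>The relative Walkup--Wets distance of two nonempty sets in \<open>cball x r\<close>, for \<open>r > 0\<close>.\<close>

definition rel_dist :: "'a::euclidean_space \<Rightarrow> real \<Rightarrow> 'a set \<Rightarrow> 'a set \<Rightarrow> ennreal" where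
  "rel_dist x r A B =
    max (excess (A \<inter> cball x r) B) (excess (B \<inter> cball x r) A) / ennreal r"

definition approximability :: "'a::euclidean_space set set \<Rightarrow> 'a set \<Rightarrow> 'a \<Rightarrow> real \<Rightarrow> ennreal" where
  "approximability \<S> A x r = (INF S\<in>\<S>. rel_dist x r A ((\<lambda>y. x + y) ` S))"

definition locally_approximable :: "real \<Rightarrow> 'a::euclidean_space set set \<Rightarrow> 'a set \<Rightarrow> bool" where
  "locally_approximable \<epsilon> \<S> A \<longleftrightarrow>
    (\<forall>K. compact K \<and> K \<subseteq> A \<longrightarrow>
      (\<exists>rK>0. \<forall>x\<in>K. \<forall>r. 0 < r \<and> r \<le> rK \<longrightarrow> approximability \<S> A x r \<le> ennreal \<epsilon>))"

text \<open>The enlargement \<open>(\<S>; \<epsilon>)\<^sup>\<Theta>\<close> at \<open>0\<close> over all scales \<open>0 < r < \<infinity>\<close>, for \<open>\<epsilon> \<ge> 0\<close>.\<close>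

definition enlargement :: "'a::euclidean_space set set \<Rightarrow> real \<Rightarrow> 'a set set" where
  "enlargement \<S> \<epsilon> =
    {D \<in> closed_through_0. \<forall>r>0. approximability \<S> D 0 r \<le> ennreal \<epsilon>}"

text \<open>Pseudotangent and tangent sets of a closed set \<open>A\<close> at \<open>x \<in> A\<close>.\<close>

definition pseudotangent_sets :: "'a::euclidean_space set \<Rightarrow> 'a \<Rightarrow> 'a set set" where
  "pseudotangent_sets A x =
    {T \<in> closed_through_0. \<exists>(p :: nat \<Rightarrow> 'a) (r :: nat \<Rightarrow> real).
       (\<forall>i. p i \<in> A \<and> r i > 0) \<and> p \<longlonglongrightarrow> x \<and> r \<longlonglongrightarrow> 0 \<and>
       Attouch_Wets_lim (\<lambda>i. (\<lambda>y. (y - p i) /\<^sub>R r i) ` A) T}"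

definition tangent_sets :: "'a::euclidean_space set \<Rightarrow> 'a \<Rightarrow> 'a set set" where
  "tangent_sets A x =
    {T \<in> closed_through_0. \<exists>r :: nat \<Rightarrow> real.
       (\<forall>i. r i > 0) \<and> r \<longlonglongrightarrow> 0 \<and>
       Attouch_Wets_lim (\<lambda>i. (\<lambda>y. (y - x) /\<^sub>R r i) ` A) T}"

definition singular_class :: "'a::euclidean_space set set \<Rightarrow> 'a set set" where
  "singular_class \<Q> =
    {D \<in> closed_through_0. Liminf (at_right 0) (\<lambda>r. approximability \<Q> D 0 r) > 0}"

text \<open>\<open>\<T>\<close> points are \<open>(\<phi>, \<Phi>)\<close> detectable in \<open>\<S>\<close>; only the values of \<open>\<Phi>\<close> on \<open>(0,1)\<close> matter.\<close>

definition points_detectable ::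
  "'a::euclidean_space set set \<Rightarrow> real \<Rightarrow> (real \<Rightarrow> real) \<Rightarrow> 'a set set \<Rightarrow> bool" where
  "points_detectable \<T> \<phi> \<Phi> \<S> \<longleftrightarrow>
    \<phi> > 0 \<and> (\<forall>s\<in>{0<..<1}. \<Phi> s > 0) \<and> Liminf (at_right 0) (\<lambda>s. ennreal (\<Phi> s)) = 0 \<and>
    (\<forall>S\<in>\<S>. \<forall>r>0. approximability \<T> S 0 r < ennreal \<phi> \<longrightarrow>
      (\<forall>s\<in>{0<..<1}. approximability \<T> S 0 (s * r) < ennreal (\<Phi> s)))"

end

theory Submission
  imports Defs
begin

text \<open>
  Write \<open>\<Theta>\<close> for approximability.  The set \<open>A\<^sub>\<Q>\<close> consists of the points of \<open>A\<close> near which \<open>A\<close> is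
  \<open>\<delta>\<close>-approximable by \<open>\<T>\<close> uniformly: one bound on the scales serves all points of \<open>A\<close> in a ball.
  This makes \<open>A\<^sub>\<Q>\<close> relatively open and locally \<open>\<delta>\<close>-approximable, and a uniform
  bound on \<open>\<Theta>\<close> passes to pseudotangents at every scale, since the blow-ups move any fixed scale
  below the bound (\<open>pseudotangent_sets_subset_enlargement\<close>).  The same remark for \<open>\<S>\<close> and \<open>\<epsilon>\<close>
  gives the inclusions in \<open>\<P>\<close>, because local approximability already is uniform near each point
  (\<open>locally_approximable_imp_uniform\<close>).

  What remains is a gap: at a point \<open>x\<close> of \<open>A\<close> outside \<open>A\<^sub>\<Q>\<close>, the value \<open>\<Theta>\<^sup>\<T>\<close> of \<open>A\<close> cannot
  merely exceed \<open>\<delta>\<close>, it is at least \<open>\<phi>/4\<close> at all small scales (\<open>not_uniform_imp_not_fits\<close>).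
  Suppose it is below \<open>\<phi>/4\<close> at one small scale \<open>r\<close>.  Then a set of \<open>\<S>\<close> close to \<open>A\<close> is close to \<open>\<T>\<close>
  within \<open>\<phi>\<close> at scale \<open>r/2\<close>, so by detectability it is close to \<open>\<T>\<close> within \<open>\<Phi> t \<le> \<delta>/4\<close> at
  scale \<open>t r/2\<close>, and \<open>A\<close> inherits \<open>3\<delta>/4\<close> at scale \<open>t r/4\<close> (\<open>detectable_step\<close>).
  Three things follow from this improvement.  The slack between \<open>3\<delta>/4\<close> and \<open>\<phi>/4\<close> lets the bound
  spread to all nearby centres \<open>y\<close>.  At each \<open>y\<close> the improvement can be repeated, as
  \<open>\<delta> \<le> \<phi>/32\<close>.  And since shrinking the scale by a factor up to \<open>4\<close> costs at most a factor \<open>4\<close> in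
  \<open>\<Theta>\<close>, each repetition reaches a whole interval of scales rather than one; the intervals
  widen until they overlap, so they cover all small scales (\<open>all_small_scales\<close>).  Hence \<open>x\<close> would
  be in \<open>A\<^sub>\<Q>\<close>.

  The gap survives in the tangent sets: if a tangent set \<open>D\<close> at \<open>x\<close> were close to a member of \<open>\<Q>\<close>
  at a single scale, then \<open>D\<close>, and with it \<open>A\<close> at a sequence of scales tending to \<open>0\<close>, would be
  within \<open>\<phi>/4\<close> of \<open>\<T>\<close> (\<open>tangent_sets_subset_singular_class\<close>).  So \<open>\<Theta>\<^sup>\<Q>\<close> of \<open>D\<close> is bounded below.
\<close>

section \<open>Pointwise descriptions of excess and approximability\<close>

definition near_set :: "'a::euclidean_space set \<Rightarrow> 'a set \<Rightarrow> real \<Rightarrow> bool" where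
  "near_set A B e \<longleftrightarrow> (\<forall>a\<in>A. \<exists>b\<in>B. dist a b < e)"

definition close_in :: "'a::euclidean_space \<Rightarrow> real \<Rightarrow> real \<Rightarrow> 'a set \<Rightarrow> 'a set \<Rightarrow> bool" where
  "close_in x r e A B \<longleftrightarrow>
    near_set (A \<inter> cball x r) B (e * r) \<and> near_set (B \<inter> cball x r) A (e * r)"

text \<open>
  Excesses are suprema of infima in \<^typ>\<open>ennreal\<close>.  All estimates below are done instead with real
  tolerances and chosen points; up to an arbitrarily small change of the tolerance, \<open>fits \<S> A x r e\<close>
  expresses \<open>approximability \<S> A x r \<le> ennreal e\<close>.  The tolerance is relative to the radius.
\<close>

definition fits :: "'a::euclidean_space set set \<Rightarrow> 'a set \<Rightarrow> 'a \<Rightarrow> real \<Rightarrow> real \<Rightarrow> bool" where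
  "fits \<S> A x r e \<longleftrightarrow> (\<exists>S\<in>\<S>. close_in x r e A ((\<lambda>y. x + y) ` S))"

lemma excess_less_imp_near_set:
  assumes "excess A B < ennreal e"
  shows "near_set A B e"
  unfolding near_set_def
proof
  fix a assume "a \<in> A"
  then have "(INF b\<in>B. ennreal (dist a b)) \<le> excess A B"
    unfolding excess_def by (rule SUP_upper)
  with assms have "(INF b\<in>B. ennreal (dist a b)) < ennreal e" by order
  then show "\<exists>b\<in>B. dist a b < e"
    by (auto simp: INF_less_iff ennreal_less_iff)
qed

lemma near_set_imp_excess_le: "near_set A B e \<Longrightarrow> excess A B \<le> ennreal e"
  unfolding near_set_def excess_def
  by (force intro!: SUP_least intro: INF_lower2 ennreal_leI less_imp_le)

lemma rel_dist_less_imp_close_in: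
  assumes "rel_dist x r A B < ennreal e" "r > 0"
  shows "close_in x r e A B"
proof -
  have e: "e > 0" using assms(1) by (metis ennreal_eq_0_iff not_less not_less_zero)
  let ?m = "max (excess (A \<inter> cball x r) B) (excess (B \<inter> cball x r) A)"
  have "?m < ennreal e * ennreal r"
    using assms unfolding rel_dist_def by (subst (asm) divide_less_ennreal) auto
  then have "?m < ennreal (e * r)" using e assms(2) by (simp add: ennreal_mult)
  then show ?thesis by (simp add: close_in_def excess_less_imp_near_set)
qed

lemma close_in_imp_rel_dist_le:
  assumes "close_in x r e A B" "r > 0" "e \<ge> 0"
  shows "rel_dist x r A B \<le> ennreal e"
proof -
  let ?m = "max (excess (A \<inter> cball x r) B) (excess (B \<inter> cball x r) A)"
  have "?m \<le> ennreal (e * r)" using assms by (simp add: close_in_def near_set_imp_excess_le)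
  then show ?thesis using assms unfolding rel_dist_def
    by (simp add: divide_le_posI_ennreal ennreal_mult mult.commute)
qed

lemma approximability_less_imp_fits:
  "approximability \<S> A x r < ennreal e \<Longrightarrow> r > 0 \<Longrightarrow> fits \<S> A x r e"
  unfolding approximability_def fits_def INF_less_iff
  by (auto intro: rel_dist_less_imp_close_in)

lemma approximability_le_imp_fits:
  assumes "approximability \<S> A x r \<le> ennreal e" "0 \<le> e" "e < e'" "r > 0"
  shows "fits \<S> A x r e'"
proof -
  have "ennreal e < ennreal e'" using assms by (simp add: ennreal_less_iff)
  with assms(1) show ?thesis using assms(4) by (intro approximability_less_imp_fits) order+
qed

lemma fits_imp_approximability_le:
  "fits \<S> A x r e \<Longrightarrow> r > 0 \<Longrightarrow> e \<ge> 0 \<Longrightarrow> approximability \<S> A x r \<le> ennreal e"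
  unfolding approximability_def fits_def
  by (auto intro: INF_lower2 close_in_imp_rel_dist_le)

lemma approximability_leI:
  assumes "\<And>e'. e' > e \<Longrightarrow> fits \<S> A x r e'" "r > 0" "e \<ge> 0"
  shows "approximability \<S> A x r \<le> ennreal e"
proof (rule ennreal_le_epsilon)
  fix d :: real assume "d > 0"
  with assms have "approximability \<S> A x r \<le> ennreal (e + d)"
    by (intro fits_imp_approximability_le) auto
  then show "approximability \<S> A x r \<le> ennreal e + ennreal d"
    using \<open>d > 0\<close> assms(3) by simp
qed

section \<open>Triangle inequality, similarity and restriction\<close>

lemma near_set_mono:
  "near_set A B e \<Longrightarrow> A' \<subseteq> A \<Longrightarrow> B \<subseteq> B' \<Longrightarrow> e \<le> e' \<Longrightarrow> near_set A' B' e'"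
  unfolding near_set_def by (meson order_less_le_trans subsetD)

lemma close_in_sym: "close_in x r e A B \<Longrightarrow> close_in x r e B A"
  by (simp add: close_in_def)

lemma close_in_mono: "close_in x r e A B \<Longrightarrow> e \<le> e' \<Longrightarrow> r \<ge> 0 \<Longrightarrow> close_in x r e' A B"
  unfolding close_in_def by (auto intro: near_set_mono mult_right_mono)

lemma fits_mono: "fits \<S> A x r e \<Longrightarrow> e \<le> e' \<Longrightarrow> r \<ge> 0 \<Longrightarrow> fits \<S> A x r e'"
  unfolding fits_def by (auto intro: close_in_mono)

text \<open>
  Only the normalising factor changes: the excesses themselves decrease with the radius.  This is
  what makes approximability at one scale control all scales comparable to it.
\<close>

lemma close_in_smaller_radius:
  assumes "close_in x r e A B" "0 < s" "s \<le> 1" "r \<ge> 0"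
  shows "close_in x (s * r) (e / s) A B"
proof -
  have "cball x (s * r) \<subseteq> cball x r"
    using assms by (intro subset_cball) (simp add: mult_left_le_one_le)
  moreover have "e / s * (s * r) = e * r" using assms by simp
  ultimately have "X \<inter> cball x (s * r) \<subseteq> X \<inter> cball x r" "e * r \<le> e / s * (s * r)" for X
    by auto
  then show ?thesis using assms(1) near_set_mono[OF _ _ order_refl] unfolding close_in_def by metis
qed

lemma fits_smaller_radius:
  "fits \<S> A x r e \<Longrightarrow> 0 < s \<Longrightarrow> s \<le> 1 \<Longrightarrow> r \<ge> 0 \<Longrightarrow> fits \<S> A x (s * r) (e / s)"
  unfolding fits_def by (auto intro: close_in_smaller_radius)

text \<open>
  The point of \<open>B\<close> next to \<open>a\<close> may lie far from \<open>x\<close>, but then \<open>x\<close> itself is a better choice, as it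
  belongs to \<open>B\<close> and has distance at most \<open>r\<close> from \<open>a\<close>.  So enlarging the radius by \<open>min r d\<close> is
  enough, whatever the tolerance \<open>d\<close> is.
\<close>

lemma near_set_trans:
  assumes AB: "near_set (A \<inter> cball x s) B d" and BC: "near_set (B \<inter> cball x r') C d'"
    and x: "x \<in> B" and r: "r \<le> s" "r + min r d \<le> r'"
  shows "near_set (A \<inter> cball x r) C (d + d')"
  unfolding near_set_def
proof
  fix a assume a: "a \<in> A \<inter> cball x r"
  then obtain b where b: "b \<in> B" "dist a b < d"
    using AB r(1) unfolding near_set_def by fastforce
  have nonneg: "0 \<le> r" "0 < d"
    using a b(2) by (auto intro: order_trans[OF zero_le_dist] order.strict_trans1[OF zero_le_dist])
  obtain b' where b': "b' \<in> B \<inter> cball x r'" "dist a b' < d"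
  proof (cases "dist a b \<le> r")
    case True
    have "dist x b \<le> dist x a + dist a b" by (rule dist_triangle)
    then show ?thesis using True a b r that[of b] by auto
  next
    case False
    then have "dist a x < d" using a b by (auto simp: dist_commute)
    then show ?thesis using that[of x] x r nonneg by auto
  qed
  then obtain c where "c \<in> C" "dist b' c < d'" using BC unfolding near_set_def by blast
  then show "\<exists>c\<in>C. dist a c < d + d'"
    using b' by (metis add_strict_mono dist_triangle order.strict_trans1)
qed

text \<open>
  Halving the radius makes the triangle inequality hold with no smallness condition on the tolerances.
\<close>

lemma close_in_trans:
  assumes "close_in x r e A B" "close_in x r e' B C" "x \<in> B" "r > 0"
  shows "close_in x (r / 2) (2 * (e + e')) A C"
proof -
  have eq: "2 * (e + e') * (r / 2) = e * r + e' * r" by (simp add: algebra_simps)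
  have "near_set (A \<inter> cball x (r / 2)) C (e * r + e' * r)"
    by (rule near_set_trans[of _ _ r B _ r]) (use assms in \<open>auto simp: close_in_def\<close>)
  moreover have "near_set (C \<inter> cball x (r / 2)) A (e' * r + e * r)"
    by (rule near_set_trans[of _ _ r B _ r]) (use assms in \<open>auto simp: close_in_def\<close>)
  ultimately show ?thesis unfolding close_in_def eq by (simp add: add.commute)
qed

lemma near_set_similarity:
  fixes A B :: "'a::euclidean_space set"
  assumes "c > 0"
  shows "near_set ((\<lambda>y. p + c *\<^sub>R y) ` A) ((\<lambda>y. p + c *\<^sub>R y) ` B) (c * e) \<longleftrightarrow> near_set A B e"
proof -
  have "dist (p + c *\<^sub>R a) (p + c *\<^sub>R b) = c * dist a b" for a b :: 'a
    using assms by (simp add: dist_norm flip: scaleR_diff_right)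
  then show ?thesis using assms by (simp add: near_set_def)
qed

lemma close_in_similarity:
  fixes A B :: "'a::euclidean_space set"
  assumes "c > 0"
  shows "close_in p (c * r) e ((\<lambda>y. p + c *\<^sub>R y) ` A) ((\<lambda>y. p + c *\<^sub>R y) ` B)
    \<longleftrightarrow> close_in 0 r e A B"
proof -
  have ball: "(\<lambda>y. p + c *\<^sub>R y) ` X \<inter> cball p (c * r) = (\<lambda>y. p + c *\<^sub>R y) ` (X \<inter> cball 0 r)"
    for X :: "'a set"
    using assms by (auto simp: dist_norm)
  have "e * (c * r) = c * (e * r)" by simp
  then show ?thesis unfolding close_in_def ball using near_set_similarity[OF assms] by metis
qed

lemma close_in_translate:
  fixes A B :: "'a::euclidean_space set"
  shows "close_in x r e ((\<lambda>y. x + y) ` A) ((\<lambda>y. x + y) ` B) \<longleftrightarrow> close_in 0 r e A B"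
  using close_in_similarity[of 1 x r e A B] by simp

lemma fits_0: "fits \<S> A 0 r e \<longleftrightarrow> (\<exists>S\<in>\<S>. close_in 0 r e A S)"
  by (simp add: fits_def)

text \<open>
  Approximability is invariant under similarities because the class is closed under dilations.
\<close>

lemma fits_blow_up:
  fixes A :: "'a::euclidean_space set"
  assumes "local_approx_class \<S>" "c > 0"
  shows "fits \<S> ((\<lambda>y. (y - q) /\<^sub>R c) ` A) 0 r e \<longleftrightarrow> fits \<S> A q (c * r) e"
proof
  let ?A = "(\<lambda>y. (y - q) /\<^sub>R c) ` A"
  have A: "(\<lambda>y. q + c *\<^sub>R y) ` ?A = A" using assms(2) by (simp add: image_image)
  have sc: "(\<lambda>y. a *\<^sub>R y) ` S \<in> \<S>" if "S \<in> \<S>" "a > 0" for S a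
    using assms(1) that by (auto simp: local_approx_class_def)
  {
    assume "fits \<S> ?A 0 r e"
    then obtain S where S: "S \<in> \<S>" "close_in 0 r e ?A S" by (auto simp: fits_0)
    then have "close_in q (c * r) e A ((\<lambda>y. q + c *\<^sub>R y) ` S)"
      using close_in_similarity[OF assms(2), of q r e ?A S] A by simp
    then show "fits \<S> A q (c * r) e"
      using sc[OF S(1) assms(2)] unfolding fits_def by (auto simp: image_image intro: rev_bexI)
  }
  {
    assume "fits \<S> A q (c * r) e"
    then obtain S where S: "S \<in> \<S>" "close_in q (c * r) e A ((\<lambda>y. q + y) ` S)"
      by (auto simp: fits_def)
    let ?S = "(\<lambda>y. (1 / c) *\<^sub>R y) ` S"
    have "(\<lambda>y. q + c *\<^sub>R y) ` ?S = (\<lambda>y. q + y) ` S"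
      using assms(2) by (simp add: image_image)
    then have "close_in 0 r e ?A ?S"
      using S(2) close_in_similarity[OF assms(2), of q r e ?A ?S] A by simp
    then show "fits \<S> ?A 0 r e" using sc[OF S(1), of "1 / c"] assms(2) by (auto simp: fits_0)
  }
qed

text \<open>
  Points of \<open>A\<close> outside \<open>cball x (2 * r)\<close> are further from each point of \<open>cball x r\<close> than
  \<open>x \<in> B\<close> is, so removing them does not increase distances to the set.
\<close>

lemma close_in_restrict:
  assumes "close_in x r e A C" "B \<subseteq> A" "A \<inter> cball x (2 * r) \<subseteq> B" "x \<in> B" "r \<ge> 0"
  shows "close_in x r e B C"
proof -
  have "near_set (C \<inter> cball x r) B (e * r)"
    unfolding near_set_def
  proof
    fix c assume c: "c \<in> C \<inter> cball x r"
    then obtain a where a: "a \<in> A" "dist c a < e * r"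
      using assms(1) unfolding close_in_def near_set_def by blast
    show "\<exists>b\<in>B. dist c b < e * r"
    proof (cases "dist c a \<le> r")
      case True
      have "dist x a \<le> dist x c + dist c a" by (rule dist_triangle)
      then have "a \<in> B" using True a(1) c assms(3) by auto
      then show ?thesis using a by blast
    next
      case False
      then have "dist c x < e * r" using a c by (auto simp: dist_commute)
      then show ?thesis using assms(4) by blast
    qed
  qed
  moreover have "near_set (B \<inter> cball x r) C (e * r)"
    using assms(1,2) unfolding close_in_def by (auto elim!: near_set_mono)
  ultimately show ?thesis by (simp add: close_in_def)
qed

lemma approximability_restrict:
  assumes "approximability \<S> A x r \<le> ennreal e" "0 \<le> e" "r > 0"
    and "B \<subseteq> A" "A \<inter> cball x (2 * r) \<subseteq> B" "x \<in> B"
  shows "approximability \<S> B x r \<le> ennreal e"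
proof (rule approximability_leI)
  fix e' assume "e' > e"
  then have "fits \<S> A x r e'" using assms by (intro approximability_le_imp_fits)
  then show "fits \<S> B x r e'"
    using close_in_restrict[OF _ assms(4-6)] assms(3) unfolding fits_def by (meson less_imp_le)
qed (use assms in auto)

section \<open>Local approximability as uniform approximability near each point\<close>

definition uniformly_approximable_near ::
  "real \<Rightarrow> 'a::euclidean_space set set \<Rightarrow> 'a set \<Rightarrow> 'a \<Rightarrow> bool" where
  "uniformly_approximable_near \<epsilon> \<S> A x \<longleftrightarrow>
    (\<exists>R>0. \<forall>y\<in>A \<inter> ball x R. \<forall>r. 0 < r \<and> r \<le> R \<longrightarrow> approximability \<S> A y r \<le> ennreal \<epsilon>)"

lemma uniformly_approximable_nearI:
  assumes "R > 0"
    and "\<And>y r. y \<in> A \<Longrightarrow> dist x y < R \<Longrightarrow> 0 < r \<Longrightarrow> r \<le> R \<Longrightarrow> approximability \<S> A y r \<le> ennreal \<epsilon>"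
  shows "uniformly_approximable_near \<epsilon> \<S> A x"
  using assms unfolding uniformly_approximable_near_def by auto

text \<open>
  \<open>A\<close> need not be locally compact.  A failure of uniformity near \<open>x\<close> yields a sequence in \<open>A\<close>
  converging to \<open>x\<close>, and such a sequence together with \<open>x\<close> is compact.
\<close>

lemma locally_approximable_imp_uniform:
  assumes "locally_approximable \<epsilon> \<S> A" "x \<in> A"
  shows "uniformly_approximable_near \<epsilon> \<S> A x"
proof (rule ccontr)
  assume "\<not> ?thesis"
  then have "\<forall>i::nat. \<exists>y r. y \<in> A \<inter> ball x (inverse (real (Suc i))) \<and> 0 < r \<and>
      r \<le> inverse (real (Suc i)) \<and> \<not> approximability \<S> A y r \<le> ennreal \<epsilon>"
    unfolding uniformly_approximable_near_def
    by (metis inverse_positive_iff_positive of_nat_0_less_iff zero_less_Suc)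
  then obtain y r where y: "\<And>i. y i \<in> A \<inter> ball x (inverse (real (Suc i)))"
    and r: "\<And>i. 0 < r i" "\<And>i. r i \<le> inverse (real (Suc i))"
    and bad: "\<And>i. \<not> approximability \<S> A (y i) (r i) \<le> ennreal \<epsilon>"
    by metis
  have "y \<longlonglongrightarrow> x"
  proof (rule metric_tendsto_imp_tendsto[OF LIMSEQ_inverse_real_of_nat])
    show "\<forall>\<^sub>F i in sequentially. dist (y i) x \<le> dist (inverse (real (Suc i))) 0"
      using y by (intro always_eventually) (auto simp: dist_commute less_imp_le)
  qed
  then have "compact (insert x (range y))" by (rule compact_sequence_with_limit)
  moreover have "insert x (range y) \<subseteq> A" using assms(2) y by auto
  ultimately obtain rK where rK: "rK > 0"
    "\<And>z s. z \<in> insert x (range y) \<Longrightarrow> 0 < s \<Longrightarrow> s \<le> rK \<Longrightarrow> approximability \<S> A z s \<le> ennreal \<epsilon>"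
    using assms(1) unfolding locally_approximable_def by meson
  obtain i :: nat where "inverse (real (Suc i)) < rK" using reals_Archimedean[OF rK(1)] by blast
  then have "approximability \<S> A (y i) (r i) \<le> ennreal \<epsilon>"
    using rK(2) r by (meson insertCI less_imp_le order_trans rangeI)
  then show False using bad by blast
qed

lemma locally_approximableI:
  assumes "\<And>x. x \<in> A \<Longrightarrow> uniformly_approximable_near \<epsilon> \<S> A x"
  shows "locally_approximable \<epsilon> \<S> A"
  unfolding locally_approximable_def
proof (intro allI impI, elim conjE)
  fix K assume K: "compact K" "K \<subseteq> A"
  obtain R where R: "\<And>x. x \<in> A \<Longrightarrow> R x > 0"
    "\<And>x y r. x \<in> A \<Longrightarrow> y \<in> A \<inter> ball x (R x) \<Longrightarrow> 0 < r \<Longrightarrow> r \<le> R x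
        \<Longrightarrow> approximability \<S> A y r \<le> ennreal \<epsilon>"
    using assms unfolding uniformly_approximable_near_def by metis
  obtain F where F: "F \<subseteq> K" "finite F" "K \<subseteq> (\<Union>x\<in>F. ball x (R x))"
  proof (rule compactE_image[OF K(1), of K "\<lambda>x. ball x (R x)"])
    show "K \<subseteq> (\<Union>x\<in>K. ball x (R x))" using R(1) K(2) by force
  qed auto
  define rK where "rK = Min (insert 1 (R ` F))"
  have "rK > 0" using F K R(1) by (auto simp: rK_def)
  moreover have "approximability \<S> A y r \<le> ennreal \<epsilon>" if "y \<in> K" "0 < r" "r \<le> rK" for y r
  proof -
    obtain x where x: "x \<in> F" "y \<in> ball x (R x)" using F(3) \<open>y \<in> K\<close> by blast
    have "rK \<le> R x" using x(1) F(2) by (simp add: rK_def)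
    then show ?thesis using R(2)[of x y r] x that K F(1) by auto
  qed
  ultimately show "\<exists>rK>0. \<forall>x\<in>K. \<forall>r. 0 < r \<and> r \<le> rK \<longrightarrow> approximability \<S> A x r \<le> ennreal \<epsilon>"
    by blast
qed

lemma openin_uniformly_approximable:
  "openin (top_of_set A) {x \<in> A. uniformly_approximable_near \<epsilon> \<S> A x}"
  unfolding openin_contains_ball
proof (intro conjI ballI)
  fix x assume "x \<in> {x \<in> A. uniformly_approximable_near \<epsilon> \<S> A x}"
  then obtain R where R: "R > 0"
    "\<And>y r. y \<in> A \<inter> ball x R \<Longrightarrow> 0 < r \<Longrightarrow> r \<le> R \<Longrightarrow> approximability \<S> A y r \<le> ennreal \<epsilon>"
    unfolding uniformly_approximable_near_def by blast
  have "uniformly_approximable_near \<epsilon> \<S> A y" if "dist x y < R / 2" for y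
  proof (rule uniformly_approximable_nearI[of "R / 2"])
    fix z r assume "z \<in> A" "dist y z < R / 2" "0 < r" "r \<le> R / 2"
    then show "approximability \<S> A z r \<le> ennreal \<epsilon>"
      using R that dist_triangle[of x z y] by (intro R(2)) auto
  qed (use R in auto)
  then show "\<exists>e>0. ball x e \<inter> A \<subseteq> {x \<in> A. uniformly_approximable_near \<epsilon> \<S> A x}"
    using R(1) by (intro exI[of _ "R / 2"]) auto
qed auto

text \<open>
  Here the approximated set is the subset and no longer \<open>A\<close>.  Near each of its points the two agree,
  by openness, and approximability only depends on the part of the set within twice the radius.
\<close>

lemma locally_approximable_uniformly_approximable:
  assumes "\<epsilon> \<ge> 0"
  shows "locally_approximable \<epsilon> \<S> {x \<in> A. uniformly_approximable_near \<epsilon> \<S> A x}"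
    (is "locally_approximable _ _ ?B")
proof (rule locally_approximableI)
  fix x assume x: "x \<in> ?B"
  then obtain R where R: "R > 0"
    "\<And>y r. y \<in> A \<inter> ball x R \<Longrightarrow> 0 < r \<Longrightarrow> r \<le> R \<Longrightarrow> approximability \<S> A y r \<le> ennreal \<epsilon>"
    unfolding uniformly_approximable_near_def by blast
  obtain d where d: "d > 0" "ball x d \<inter> A \<subseteq> ?B"
    using openin_uniformly_approximable[of A \<epsilon> \<S>] x unfolding openin_contains_ball by blast
  define \<rho> where "\<rho> = min R (d / 3)"
  have \<rho>: "\<rho> > 0" "\<rho> \<le> R" "3 * \<rho> \<le> d" using R d by (auto simp: \<rho>_def)
  show "uniformly_approximable_near \<epsilon> \<S> ?B x"
  proof (rule uniformly_approximable_nearI[OF \<open>\<rho> > 0\<close>])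
    fix y r assume y: "y \<in> ?B" "dist x y < \<rho>" and r: "0 < r" "r \<le> \<rho>"
    show "approximability \<S> ?B y r \<le> ennreal \<epsilon>"
    proof (rule approximability_restrict)
      have "y \<in> A \<inter> ball x R" using y \<rho>(2) by simp
      moreover have "r \<le> R" using r(2) \<rho>(2) by linarith
      ultimately show "approximability \<S> A y r \<le> ennreal \<epsilon>" using r(1) by (intro R(2))
      show "0 \<le> \<epsilon>" "0 < r" "?B \<subseteq> A" "y \<in> ?B" using assms r(1) y(1) by blast+
      have "dist x z < d" if "dist y z \<le> 2 * r" for z
        using dist_triangle[of x z y] that y(2) r(2) \<rho>(3) by linarith
      then have "A \<inter> cball y (2 * r) \<subseteq> ball x d \<inter> A" by auto
      then show "A \<inter> cball y (2 * r) \<subseteq> ?B" using d(2) by (rule order_trans)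
    qed
  qed
qed

section \<open>Tangent and pseudotangent sets\<close>

lemma Attouch_Wets_lim_imp_close_in:
  assumes "Attouch_Wets_lim X D" "r > 0" "e > 0"
  shows "\<forall>\<^sub>F i in sequentially. close_in 0 r e (X i) D"
proof -
  have "(\<lambda>i. excess (X i \<inter> cball 0 r) D) \<longlonglongrightarrow> 0" "(\<lambda>i. excess (D \<inter> cball 0 r) (X i)) \<longlonglongrightarrow> 0"
    using assms by (auto simp: Attouch_Wets_lim_def)
  moreover have "0 < ennreal (e * r)" using assms by simp
  ultimately have "\<forall>\<^sub>F i in sequentially. excess (X i \<inter> cball 0 r) D < ennreal (e * r)"
    "\<forall>\<^sub>F i in sequentially. excess (D \<inter> cball 0 r) (X i) < ennreal (e * r)"
    by (blast dest: order_tendstoD(2))+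
  then show ?thesis
    by eventually_elim (simp add: close_in_def excess_less_imp_near_set)
qed

text \<open>
  Moves the base point \<open>p\<close> to \<open>q\<close> and replaces the closure of \<open>A\<close> by \<open>A\<close>.  Of the total tolerance
  \<open>e * r\<close>, one half is used by the approximation at radius \<open>2 * r\<close>, one quarter by the change of base
  point and one quarter by the passage to the closure.
\<close>

lemma close_in_blow_up_perturb:
  fixes A :: "'a::euclidean_space set"
  assumes cl: "close_in 0 (2 * r) (e / 4) ((\<lambda>y. (y - p) /\<^sub>R c) ` closure A) D"
    and pos: "c > 0" "r > 0" "e > 0" and pq: "dist p q \<le> c * min r (e * r / 4)"
  shows "close_in 0 r e ((\<lambda>y. (y - q) /\<^sub>R c) ` A) D"
proof -
  have shift: "dist ((a - p) /\<^sub>R c) ((a - q) /\<^sub>R c) \<le> min r (e * r / 4)" for a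
  proof -
    have "dist ((a - p) /\<^sub>R c) ((a - q) /\<^sub>R c) = dist p q / c"
      using pos(1) by (simp add: dist_norm norm_minus_commute divide_inverse_commute
          flip: scaleR_diff_right)
    also have "\<dots> \<le> min r (e * r / 4)"
      using pq pos(1) by (subst pos_divide_le_eq) (auto simp: mult.commute)
    finally show ?thesis .
  qed
  have "near_set ((\<lambda>y. (y - q) /\<^sub>R c) ` A \<inter> cball 0 r) D (e * r)"
    unfolding near_set_def
  proof
    fix z assume z: "z \<in> (\<lambda>y. (y - q) /\<^sub>R c) ` A \<inter> cball 0 r"
    then obtain a where a: "a \<in> A" "z = (a - q) /\<^sub>R c" by blast
    define z' where "z' = (a - p) /\<^sub>R c"
    have zz: "dist z z' \<le> r" "dist z z' \<le> e * r / 4"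
      using shift[of a] by (auto simp: a z'_def dist_commute)
    have "dist 0 z' \<le> 2 * r" using zz(1) z dist_triangle[of 0 z' z] by auto
    moreover have "a \<in> closure A" using a(1) closure_subset by blast
    ultimately obtain d where "d \<in> D" "dist z' d < e / 4 * (2 * r)"
      using cl unfolding close_in_def near_set_def z'_def by fastforce
    then show "\<exists>d\<in>D. dist z d < e * r"
      using zz(2) dist_triangle[of z d z'] mult_pos_pos[OF pos(3,2)] by (intro bexI[of _ d]) auto
  qed
  moreover have "near_set (D \<inter> cball 0 r) ((\<lambda>y. (y - q) /\<^sub>R c) ` A) (e * r)"
    unfolding near_set_def
  proof
    fix d assume d: "d \<in> D \<inter> cball 0 r"
    then obtain a where a: "a \<in> closure A" "dist d ((a - p) /\<^sub>R c) < e / 4 * (2 * r)"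
      using cl pos unfolding close_in_def near_set_def by fastforce
    have "c * (e * r / 4) > 0" using pos by simp
    then obtain a' where a': "a' \<in> A" "dist a' a < c * (e * r / 4)"
      using a(1) unfolding closure_approachable by blast
    have "dist ((a - p) /\<^sub>R c) ((a' - p) /\<^sub>R c) = dist a' a / c"
      using pos(1) by (simp add: dist_norm norm_minus_commute divide_inverse_commute
          flip: scaleR_diff_right)
    also have "\<dots> < e * r / 4" using a'(2) pos(1) by (simp add: pos_divide_less_eq mult.commute)
    finally have "dist d ((a' - q) /\<^sub>R c) < e * r"
      using a(2) shift[of a'] dist_triangle[of d "(a' - q) /\<^sub>R c" "(a' - p) /\<^sub>R c"]
        dist_triangle[of d "(a' - p) /\<^sub>R c" "(a - p) /\<^sub>R c"] by simp
    then show "\<exists>b\<in>(\<lambda>y. (y - q) /\<^sub>R c) ` A. dist d b < e * r" using a'(1) by blast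
  qed
  ultimately show ?thesis by (simp add: close_in_def)
qed

text \<open>
  Local approximability gives information at points of \<open>A\<close> only, so the base points in the closure are
  replaced by points of \<open>A\<close> at distance \<open>o(r i)\<close>; this does not change the limit of the blow-ups.
\<close>

lemma pseudotangent_setE:
  assumes "D \<in> pseudotangent_sets (closure A) x"
  obtains q r where "\<forall>i. q i \<in> A" "\<forall>i. r i > 0" "q \<longlonglongrightarrow> x" "r \<longlonglongrightarrow> 0"
    "\<forall>s>0. \<forall>e>0. \<forall>\<^sub>F i in sequentially. close_in 0 s e ((\<lambda>y. (y - q i) /\<^sub>R r i) ` A) D"
proof -
  obtain p r where p: "\<And>i. p i \<in> closure A" and r: "\<And>i. r i > 0" and lim: "p \<longlonglongrightarrow> x" "r \<longlonglongrightarrow> 0"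
    and AW: "Attouch_Wets_lim (\<lambda>i. (\<lambda>y. (y - p i) /\<^sub>R r i) ` closure A) D"
    using assms unfolding pseudotangent_sets_def by blast
  have "\<exists>q\<in>A. dist q (p i) < r i * inverse (real (Suc i))" for i
  proof -
    have "r i * inverse (real (Suc i)) > 0" using r[of i] by simp
    then show ?thesis using p[of i] unfolding closure_approachable by blast
  qed
  then obtain q where q: "\<And>i. q i \<in> A" "\<And>i. dist (q i) (p i) < r i * inverse (real (Suc i))"
    by metis
  have "\<forall>\<^sub>F i in sequentially. norm (dist (q i) (p i)) \<le> r i * inverse (real (Suc i))"
    using less_imp_le[OF q(2)]
    by (intro always_eventually allI) (simp only: real_norm_def abs_of_nonneg zero_le_dist)
  moreover have "(\<lambda>i. r i * inverse (real (Suc i))) \<longlonglongrightarrow> 0"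
    using tendsto_mult[OF lim(2) LIMSEQ_inverse_real_of_nat] by simp
  ultimately have "(\<lambda>i. dist (q i) (p i)) \<longlonglongrightarrow> 0" by (rule Lim_null_comparison)
  then have "(\<lambda>i. q i - p i) \<longlonglongrightarrow> 0" by (simp add: dist_norm tendsto_norm_zero_iff)
  from tendsto_add[OF this lim(1)] have "q \<longlonglongrightarrow> x" by simp
  have conv: "\<forall>\<^sub>F i in sequentially. close_in 0 s e ((\<lambda>y. (y - q i) /\<^sub>R r i) ` A) D"
    if "s > 0" "e > 0" for s e
  proof -
    have "\<forall>\<^sub>F i in sequentially. inverse (real (Suc i)) < min s (e * s / 4)"
      using that by (intro order_tendstoD(2)[OF LIMSEQ_inverse_real_of_nat]) auto
    moreover have "\<forall>\<^sub>F i in sequentially.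
        close_in 0 (2 * s) (e / 4) ((\<lambda>y. (y - p i) /\<^sub>R r i) ` closure A) D"
      using that by (intro Attouch_Wets_lim_imp_close_in[OF AW]) auto
    ultimately show ?thesis
    proof eventually_elim
      case (elim i)
      have "r i * inverse (real (Suc i)) \<le> r i * min s (e * s / 4)"
        using elim(1) r[of i] by (intro mult_left_mono) auto
      then have "dist (p i) (q i) \<le> r i * min s (e * s / 4)"
        using q(2)[of i] unfolding dist_commute[of "q i"] by linarith
      with elim(2) r that show ?case by (rule close_in_blow_up_perturb)
    qed
  qed
  show ?thesis
    by (rule that[of q r]) (use q(1) r lim(2) \<open>q \<longlonglongrightarrow> x\<close> conv in auto)
qed

lemma tangent_setE:
  assumes "D \<in> tangent_sets (closure A) x"
  obtains r where "\<forall>i. r i > 0" "r \<longlonglongrightarrow> 0"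
    "\<forall>s>0. \<forall>e>0. \<forall>\<^sub>F i in sequentially. close_in 0 s e ((\<lambda>y. (y - x) /\<^sub>R r i) ` A) D"
proof -
  obtain r where r: "\<And>i. r i > 0" "r \<longlonglongrightarrow> 0"
    and AW: "Attouch_Wets_lim (\<lambda>i. (\<lambda>y. (y - x) /\<^sub>R r i) ` closure A) D"
    using assms unfolding tangent_sets_def by blast
  have "\<forall>\<^sub>F i in sequentially. close_in 0 s e ((\<lambda>y. (y - x) /\<^sub>R r i) ` A) D"
    if "s > 0" "e > 0" for s e
  proof -
    have "\<forall>\<^sub>F i in sequentially.
        close_in 0 (2 * s) (e / 4) ((\<lambda>y. (y - x) /\<^sub>R r i) ` closure A) D"
      using that by (intro Attouch_Wets_lim_imp_close_in[OF AW]) auto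
    then show ?thesis
    proof eventually_elim
      case (elim i)
      have "dist x x \<le> r i * min s (e * s / 4)" using r(1)[of i] that by simp
      with elim r(1) that show ?case by (rule close_in_blow_up_perturb)
    qed
  qed
  then show ?thesis using r by (intro that) auto
qed

lemma tangent_sets_subset_pseudotangent_sets:
  "x \<in> A \<Longrightarrow> tangent_sets A x \<subseteq> pseudotangent_sets A x"
  unfolding tangent_sets_def pseudotangent_sets_def by (force intro: exI[of _ "\<lambda>_. x"])

text \<open>
  Bounds valid at every radius pass to the limit without loss: compare at the slightly larger
  radius \<open>(1 + h) * r\<close>, then let \<open>h\<close> be small.
\<close>

lemma limit_fits:
  assumes lim: "\<And>s e. s > 0 \<Longrightarrow> e > 0 \<Longrightarrow> \<forall>\<^sub>F i in sequentially. close_in 0 s e (X i) D"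
    and fit: "\<And>s e. s > 0 \<Longrightarrow> e > \<epsilon> \<Longrightarrow> \<forall>\<^sub>F i in sequentially. fits \<S> (X i) 0 s e"
    and X: "\<And>i. 0 \<in> X i" and "\<epsilon> \<ge> 0" "r > 0" "e > \<epsilon>"
  shows "fits \<S> D 0 r e"
proof -
  \<comment> \<open>The errors add up to at most \<open>\<epsilon> + h * (\<epsilon> + 2) + h\<^sup>2\<close>, and \<open>h\<^sup>2 \<le> h\<close>.\<close>
  define h where "h = min 1 ((e - \<epsilon>) / (\<epsilon> + 3))"
  have h: "0 < h" "h \<le> 1" using assms(4-6) by (auto simp: h_def)
  have "h \<le> (e - \<epsilon>) / (\<epsilon> + 3)" by (simp add: h_def)
  then have h': "h * (\<epsilon> + 3) \<le> e - \<epsilon>" using assms(4) by (simp add: pos_le_divide_eq)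
  define r' where "r' = (1 + h) * r"
  have "r' > 0" using h assms(5) by (simp add: r'_def)
  have "\<forall>\<^sub>F i in sequentially. close_in 0 (2 * r') (h / 4) (X i) D \<and> fits \<S> (X i) 0 r' (\<epsilon> + h)"
    using h \<open>r' > 0\<close> by (intro eventually_conj lim fit) auto
  then obtain i where XD: "close_in 0 (2 * r') (h / 4) (X i) D" and "fits \<S> (X i) 0 r' (\<epsilon> + h)"
    by (auto simp: eventually_sequentially)
  then obtain S where S: "S \<in> \<S>" "close_in 0 r' (\<epsilon> + h) (X i) S" by (auto simp: fits_0)
  have hh: "h * h \<le> h" using h by (simp add: mult_left_le)
  have d: "h / 4 * (2 * r') \<le> h * r"
    using h assms(5) by (simp add: r'_def mult_left_mono)
  have "(\<epsilon> + h) * (1 + h) + h = \<epsilon> + h * (\<epsilon> + 2) + h * h" by (simp add: algebra_simps)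
  also have "\<dots> \<le> e" using h' hh by (simp add: algebra_simps)
  finally have "((\<epsilon> + h) * (1 + h) + h) * r \<le> e * r" using assms(5) by simp
  then have total: "h / 4 * (2 * r') + (\<epsilon> + h) * r' \<le> e * r"
    using d by (simp add: r'_def algebra_simps)
  have DS: "near_set (D \<inter> cball 0 r) S (h / 4 * (2 * r') + (\<epsilon> + h) * r')"
  proof (rule near_set_trans[of _ _ "2 * r'" "X i" _ r'])
    show "r + min r (h / 4 * (2 * r')) \<le> r'" using d by (simp add: r'_def algebra_simps)
  qed (use XD S X h assms(5) in \<open>auto simp: close_in_def r'_def\<close>)
  have SD: "near_set (S \<inter> cball 0 r) D ((\<epsilon> + h) * r' + h / 4 * (2 * r'))"
  proof (rule near_set_trans[of _ _ r' "X i" _ "2 * r'"])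
    show "r \<le> r'" using h assms(5) by (simp add: r'_def)
    then show "r + min r ((\<epsilon> + h) * r') \<le> 2 * r'" by linarith
  qed (use XD S X in \<open>auto simp: close_in_def\<close>)
  have "close_in 0 r e D S"
    unfolding close_in_def
    by (intro conjI near_set_mono[OF DS order_refl order_refl total]
        near_set_mono[OF SD order_refl order_refl]) (use total in simp)
  then show ?thesis using S(1) by (auto simp: fits_0)
qed

lemma pseudotangent_sets_subset_enlargement:
  assumes \<S>: "local_approx_class \<S>" and "\<epsilon> \<ge> 0" and unif: "uniformly_approximable_near \<epsilon> \<S> A x"
  shows "pseudotangent_sets (closure A) x \<subseteq> enlargement \<S> \<epsilon>"
proof
  fix D assume D: "D \<in> pseudotangent_sets (closure A) x"
  then obtain q r where q: "\<forall>i. q i \<in> A" and r: "\<forall>i. r i > 0"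
    and limits: "q \<longlonglongrightarrow> x" "r \<longlonglongrightarrow> 0"
    and lim: "\<forall>s>0. \<forall>e>0. \<forall>\<^sub>F i in sequentially. close_in 0 s e ((\<lambda>y. (y - q i) /\<^sub>R r i) ` A) D"
    by (rule pseudotangent_setE)
  obtain R where R: "R > 0"
    "\<And>y s. y \<in> A \<inter> ball x R \<Longrightarrow> 0 < s \<Longrightarrow> s \<le> R \<Longrightarrow> approximability \<S> A y s \<le> ennreal \<epsilon>"
    using unif unfolding uniformly_approximable_near_def by blast
  have fit: "\<forall>\<^sub>F i in sequentially. fits \<S> ((\<lambda>y. (y - q i) /\<^sub>R r i) ` A) 0 s e"
    if "s > 0" "e > \<epsilon>" for s e
  proof -
    have "\<forall>\<^sub>F i in sequentially. q i \<in> ball x R"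
      using tendstoD[OF limits(1) R(1)] by (simp add: dist_commute)
    moreover have "\<forall>\<^sub>F i in sequentially. r i < R / s"
      using limits(2) R(1) that by (intro order_tendstoD(2)) auto
    ultimately show ?thesis
    proof eventually_elim
      case (elim i)
      then have "approximability \<S> A (q i) (r i * s) \<le> ennreal \<epsilon>"
        using q r that by (intro R(2)) (auto simp: pos_less_divide_eq less_imp_le)
      then have "fits \<S> A (q i) (r i * s) e"
        using assms(2) that r by (intro approximability_le_imp_fits) auto
      then show ?case using fits_blow_up[OF \<S>] r by blast
    qed
  qed
  have "fits \<S> D 0 s e" if "s > 0" "e > \<epsilon>" for s e
    by (rule limit_fits[OF lim[rule_format] fit]) (use q assms(2) that in \<open>auto intro: image_eqI\<close>)
  then have "approximability \<S> D 0 s \<le> ennreal \<epsilon>" if "s > 0" for s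
    using assms(2) that by (intro approximability_leI)
  then show "D \<in> enlargement \<S> \<epsilon>"
    using D by (auto simp: enlargement_def pseudotangent_sets_def)
qed

section \<open>Propagation of approximability by the detectable class\<close>

lemma fits_nearby_centre:
  assumes fit: "fits \<S> A x r e" and "r > 0" and xy: "dist x y \<le> r / 2" "dist x y \<le> d * r"
  shows "fits \<S> A y (r / 2) (2 * (e + d))"
proof -
  obtain S where S: "S \<in> \<S>" "close_in x r e A ((\<lambda>z. x + z) ` S)" using fit by (auto simp: fits_def)
  have eq: "2 * (e + d) * (r / 2) = e * r + d * r" by (simp add: algebra_simps)
  have "near_set (A \<inter> cball y (r / 2)) ((\<lambda>z. y + z) ` S) (e * r + d * r)"
    unfolding near_set_def
  proof
    fix a assume a: "a \<in> A \<inter> cball y (r / 2)"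
    then have "dist x a \<le> r" using xy(1) dist_triangle[of x a y] by auto
    then have "a \<in> A \<inter> cball x r" using a by auto
    then obtain z where z: "z \<in> S" "dist a (x + z) < e * r"
      using S(2) unfolding close_in_def near_set_def by blast
    have "dist (x + z) (y + z) = dist x y" by simp
    then have "dist a (y + z) < e * r + d * r"
      using z(2) xy(2) dist_triangle[of a "y + z" "x + z"] by linarith
    then show "\<exists>b\<in>(\<lambda>z. y + z) ` S. dist a b < e * r + d * r" using z(1) by blast
  qed
  moreover have "near_set ((\<lambda>z. y + z) ` S \<inter> cball y (r / 2)) A (e * r + d * r)"
    unfolding near_set_def
  proof
    fix b assume "b \<in> (\<lambda>z. y + z) ` S \<inter> cball y (r / 2)"
    then obtain z where z: "z \<in> S" "b = y + z" "norm z \<le> r / 2" by (auto simp: dist_norm)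
    then have "x + z \<in> (\<lambda>z. x + z) ` S \<inter> cball x r" using \<open>r > 0\<close> by (auto simp: dist_norm)
    then obtain a where a: "a \<in> A" "dist (x + z) a < e * r"
      using S(2) unfolding close_in_def near_set_def by blast
    have "dist b (x + z) = dist x y" by (simp add: z dist_commute)
    then have "dist b a < e * r + d * r"
      using a(2) xy(2) dist_triangle[of b a "x + z"] by linarith
    then show "\<exists>a\<in>A. dist b a < e * r + d * r" using a(1) by blast
  qed
  ultimately show ?thesis using S(1) eq unfolding fits_def close_in_def by metis
qed

text \<open>
  The step carries \<open>P\<close> from \<open>\<sigma>\<close> to all scales between \<open>t\<sigma>/16\<close> and \<open>t\<sigma>/4\<close>, so \<open>k\<close> steps carry it from
  \<open>\<rho>\<close> to all scales between \<open>(t/16)\<^sup>k \<rho>\<close> and \<open>(t/4)\<^sup>k \<rho>\<close>.  The ratio \<open>4\<^sup>k\<close> of the end points grows, and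
  as soon as \<open>4\<^sup>k \<ge> 4/t\<close> consecutive intervals overlap.  The threshold \<open>\<kappa>\<close> depends on \<open>t\<close>
  only, which makes the result uniform over all centres.
\<close>

lemma all_small_scales:
  fixes t :: real
  assumes t: "0 < t" "t < 1"
  shows "\<exists>\<kappa>>0. \<forall>P \<rho> \<sigma>. P \<rho> \<longrightarrow>
      (\<forall>\<sigma> s. P \<sigma> \<longrightarrow> 0 < \<sigma> \<longrightarrow> \<sigma> \<le> \<rho> \<longrightarrow> 1/4 \<le> s \<longrightarrow> s \<le> 1 \<longrightarrow> P (t / 4 * s * \<sigma>)) \<longrightarrow>
      0 < \<sigma> \<longrightarrow> \<sigma> \<le> \<kappa> * \<rho> \<longrightarrow> P \<sigma>"
proof -
  obtain N :: nat where N: "(1/4) ^ N < t / 4"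
    using real_arch_pow_inv[of "t / 4" "1/4"] t by auto
  define \<kappa> where "\<kappa> = (t / 4) ^ N"
  show ?thesis
  proof (rule exI[of _ \<kappa>], intro conjI allI impI)
    show "0 < \<kappa>" using t by (simp add: \<kappa>_def)
    fix P :: "real \<Rightarrow> bool" and \<rho> \<sigma> :: real
    assume P: "P \<rho>" and \<sigma>: "0 < \<sigma>" "\<sigma> \<le> \<kappa> * \<rho>"
      and "\<forall>\<sigma> s. P \<sigma> \<longrightarrow> 0 < \<sigma> \<longrightarrow> \<sigma> \<le> \<rho> \<longrightarrow> 1/4 \<le> s \<longrightarrow> s \<le> 1 \<longrightarrow> P (t / 4 * s * \<sigma>)"
    note step = this(4)[rule_format]
    have "\<rho> > 0" using \<sigma> \<open>0 < \<kappa>\<close> by (meson order_less_le_trans zero_less_mult_pos)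
    have block: "P (u * \<rho>)" if "(t / 16) ^ k \<le> u" "u \<le> (t / 4) ^ k" for k u
      using that
    proof (induction k arbitrary: u)
      case 0
      then show ?case using P by simp
    next
      case (Suc k)
      \<comment> \<open>The scale \<open>v * \<rho>\<close> lies in the \<open>k\<close>-th interval and reaches \<open>u * \<rho>\<close> in one step.\<close>
      define v where "v = max ((t / 16) ^ k) (4 * u / t)"
      have pow: "(t / 16) ^ k \<le> (t / 4) ^ k" using t by (intro power_mono) auto
      have v: "(t / 16) ^ k \<le> v" "v \<le> (t / 4) ^ k"
        using Suc.prems(2) pow t by (auto simp: v_def field_simps)
      have "v > 0" using v(1) t by (smt (verit) zero_less_power divide_pos_pos)
      have "(t / 4) ^ k \<le> 1" using t by (intro power_le_one) auto
      then have v1: "v * \<rho> \<le> \<rho>" using v(2) \<open>\<rho> > 0\<close> by simp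
      have "(t / 16) ^ Suc k > 0" using t by simp
      then have "u > 0" using Suc.prems(1) by linarith
      define s where "s = 4 * u / (t * v)"
      have "t * v / 16 \<le> u" using Suc.prems(1) t \<open>u > 0\<close> by (auto simp: v_def max_def)
      moreover have "4 * u \<le> t * v" using t by (auto simp: v_def max_def field_simps)
      ultimately have "1/4 \<le> s" "s \<le> 1" using t \<open>v > 0\<close> by (auto simp: s_def field_simps)
      moreover have "P (v * \<rho>)" by (rule Suc.IH[OF v])
      ultimately have "P (t / 4 * s * (v * \<rho>))"
        using v1 \<open>v > 0\<close> \<open>\<rho> > 0\<close> by (intro step) auto
      moreover have "t / 4 * s * (v * \<rho>) = u * \<rho>" using t \<open>v > 0\<close> by (simp add: s_def)
      ultimately show ?case by (simp only:)
    qed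
    define u where "u = \<sigma> / \<rho>"
    have u: "0 < u" "u \<le> (t / 4) ^ N" using \<sigma> \<open>\<rho> > 0\<close> by (auto simp: u_def \<kappa>_def pos_divide_le_eq)
    obtain k where k: "N \<le> k" "u \<le> (t / 4) ^ k" "(t / 4) ^ Suc k < u"
    proof -
      define m where "m = (LEAST m. (t / 4) ^ m < u)"
      have "\<exists>m. (t / 4) ^ m < u" using real_arch_pow_inv[of u "t / 4"] u t by auto
      then have m: "(t / 4) ^ m < u" unfolding m_def by (rule LeastI_ex)
      have least: "u \<le> (t / 4) ^ j" if "j < m" for j
        using not_less_Least[of j "\<lambda>m. (t / 4) ^ m < u"] that by (auto simp: m_def not_less)
      have "N < m"
      proof (rule ccontr)
        assume "\<not> N < m"
        then have "(t / 4) ^ N \<le> (t / 4) ^ m" using t by (intro power_decreasing) auto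
        then show False using m u by simp
      qed
      then obtain k where "m = Suc k" "N \<le> k" by (cases m) auto
      then show thesis using that m least[of k] by auto
    qed
    have "(t / 16) ^ k = (1/4) ^ k * (t / 4) ^ k" by (simp flip: power_mult_distrib)
    also have "\<dots> \<le> (1/4) ^ N * (t / 4) ^ k"
      using k(1) t by (intro mult_right_mono power_decreasing) auto
    also have "\<dots> \<le> t / 4 * (t / 4) ^ k" using N t by (intro mult_right_mono) auto
    finally have "(t / 16) ^ k \<le> u" using k(3) by simp
    then have "P (u * \<rho>)" using k(2) by (rule block)
    then show "P \<sigma>" using \<open>\<rho> > 0\<close> by (simp add: u_def)
  qed
qed

text \<open>
  The self-improvement behind the theorem: closeness \<open>\<phi>/4\<close> becomes \<open>3\<delta>/4\<close> at a smaller scale.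
  A member \<open>S\<close> of \<open>\<S>\<close> serves as intermediary, through two applications of \<open>close_in_trans\<close>.  The first
  one gives closeness \<open>2(t\<delta>/16 + \<phi>/4) \<le> 3\<phi>/4 < \<phi>\<close> of \<open>S\<close> to \<open>\<T>\<close>, so that detectability applies.
  For the second one, \<open>S\<close> and \<open>A\<close> are compared at radius \<open>t r/2\<close>, where the tolerance \<open>t\<delta>/16\<close> has grown
  to \<open>\<delta>/8\<close>, and \<open>2(\<delta>/8 + \<delta>/4) = 3\<delta>/4\<close>.
\<close>

lemma detectable_step:
  assumes \<T>: "\<T> \<subseteq> closed_through_0" and \<S>: "\<S> \<subseteq> closed_through_0"
    and det: "points_detectable \<T> \<phi> \<Phi> \<S>"
    and \<delta>: "\<delta> \<le> \<phi> / 32" and t: "t \<in> {0<..<1}" "\<Phi> t \<le> \<delta> / 4"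
    and x: "x \<in> A" and r: "r > 0"
    and S: "fits \<S> A x r (t * \<delta> / 16)" and T: "fits \<T> A x r (\<phi> / 4)"
  shows "fits \<T> A x (t / 4 * r) (3 * \<delta> / 4)"
proof -
  have \<phi>: "\<phi> > 0" and \<Phi>: "\<Phi> t > 0"
    and detS: "\<And>S r. S \<in> \<S> \<Longrightarrow> r > 0 \<Longrightarrow> approximability \<T> S 0 r < ennreal \<phi>
        \<Longrightarrow> approximability \<T> S 0 (t * r) < ennreal (\<Phi> t)"
    using det t(1) unfolding points_detectable_def by auto
  have "t * \<delta> \<le> \<delta>" using t \<Phi> by simp
  then have "t * \<delta> / 16 \<le> \<phi> / 8" using \<delta> \<phi> by linarith
  then have le: "2 * (t * \<delta> / 16 + \<phi> / 4) \<le> 3 / 4 * \<phi>" by (simp add: algebra_simps)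
  obtain S where S: "S \<in> \<S>" "close_in x r (t * \<delta> / 16) A ((\<lambda>y. x + y) ` S)"
    using S by (auto simp: fits_def)
  obtain T where T: "T \<in> \<T>" "close_in x r (\<phi> / 4) A ((\<lambda>y. x + y) ` T)"
    using T by (auto simp: fits_def)
  have "close_in x (r / 2) (2 * (t * \<delta> / 16 + \<phi> / 4)) ((\<lambda>y. x + y) ` S) ((\<lambda>y. x + y) ` T)"
    using S(2) T(2) x r by (intro close_in_trans[of x r _ _ A]) (auto intro: close_in_sym)
  then have "close_in x (r / 2) (3 / 4 * \<phi>) ((\<lambda>y. x + y) ` S) ((\<lambda>y. x + y) ` T)"
    using le r by (auto intro: close_in_mono)
  then have "fits \<T> S 0 (r / 2) (3 / 4 * \<phi>)" using T(1) by (auto simp: close_in_translate fits_0)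
  then have "approximability \<T> S 0 (r / 2) \<le> ennreal (3 / 4 * \<phi>)"
    using r \<phi> by (intro fits_imp_approximability_le) auto
  also have "\<dots> < ennreal \<phi>" using \<phi> by (simp add: ennreal_less_iff)
  finally have "approximability \<T> S 0 (t * (r / 2)) < ennreal (\<Phi> t)"
    using S(1) r by (intro detS) auto
  then have "fits \<T> S 0 (t * (r / 2)) (\<Phi> t)"
    using r t by (intro approximability_less_imp_fits) auto
  then have "fits \<T> S 0 (t / 2 * r) (\<delta> / 4)"
    using t r by (auto intro: fits_mono)
  then obtain T' where T': "T' \<in> \<T>" "close_in x (t / 2 * r) (\<delta> / 4) ((\<lambda>y. x + y) ` S) ((\<lambda>y. x + y) ` T')"
    by (auto simp: fits_0 close_in_translate)
  have "close_in x (t / 2 * r) (t * \<delta> / 16 / (t / 2)) A ((\<lambda>y. x + y) ` S)"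
    using S(2) t r by (intro close_in_smaller_radius) auto
  then have "close_in x (t / 2 * r) (\<delta> / 8) A ((\<lambda>y. x + y) ` S)" using t by simp
  moreover have "x \<in> (\<lambda>y. x + y) ` S"
    using S(1) \<S> by (force simp: closed_through_0_def)
  ultimately have "close_in x (t / 2 * r / 2) (2 * (\<delta> / 8 + \<delta> / 4)) A ((\<lambda>y. x + y) ` T')"
    using T'(2) t r by (intro close_in_trans) auto
  then show ?thesis using T'(1) by (auto simp: fits_def)
qed

text \<open>
  By contraposition.  From a fit of \<open>A\<close> at \<open>x\<close> with tolerance \<open>\<phi>/4\<close>, \<open>detectable_step\<close> produces
  tolerance \<open>3\<delta>/4\<close> at \<open>x\<close>, hence at most \<open>\<phi>/4\<close> at all centres near \<open>x\<close>, where it is applied again and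
  then iterated through all small scales.
\<close>

lemma not_uniform_imp_not_fits:
  assumes \<T>: "\<T> \<subseteq> closed_through_0" and \<S>: "\<S> \<subseteq> closed_through_0"
    and det: "points_detectable \<T> \<phi> \<Phi> \<S>"
    and \<delta>: "\<delta> \<le> \<phi> / 32" and t: "t \<in> {0<..<1}" "\<Phi> t \<le> \<delta> / 4"
    and \<epsilon>: "0 \<le> \<epsilon>" "\<epsilon> < t * \<delta> / 16"
    and x: "x \<in> A" and unif: "uniformly_approximable_near \<epsilon> \<S> A x"
    and bad: "\<not> uniformly_approximable_near \<delta> \<T> A x"
  obtains R where "R > 0" "\<And>r. 0 < r \<Longrightarrow> r \<le> R \<Longrightarrow> \<not> fits \<T> A x r (\<phi> / 4)"
proof -
  have "\<delta> > 0" using det t unfolding points_detectable_def by fastforce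
  obtain R where R: "R > 0"
    "\<And>y r. y \<in> A \<inter> ball x R \<Longrightarrow> 0 < r \<Longrightarrow> r \<le> R \<Longrightarrow> approximability \<S> A y r \<le> ennreal \<epsilon>"
    using unif unfolding uniformly_approximable_near_def by blast
  have step: "fits \<T> A y (t / 4 * r) (3 * \<delta> / 4)"
    if "y \<in> A \<inter> ball x R" "0 < r" "r \<le> R" "fits \<T> A y r (\<phi> / 4)" for y r
  proof (rule detectable_step[OF \<T> \<S> det \<delta> t])
    show "fits \<S> A y r (t * \<delta> / 16)"
      using R(2)[OF that(1-3)] \<epsilon> that(2) by (rule approximability_le_imp_fits)
  qed (use that in auto)
  have "0 < t" "t < 1" using t(1) by auto
  from all_small_scales[OF this] obtain \<kappa> where \<kappa>: "0 < \<kappa>"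
    and cover: "\<forall>P \<rho> \<sigma>. P \<rho> \<longrightarrow>
      (\<forall>\<sigma> s. P \<sigma> \<longrightarrow> 0 < \<sigma> \<longrightarrow> \<sigma> \<le> \<rho> \<longrightarrow> 1/4 \<le> s \<longrightarrow> s \<le> 1 \<longrightarrow> P (t / 4 * s * \<sigma>)) \<longrightarrow>
      0 < \<sigma> \<longrightarrow> \<sigma> \<le> \<kappa> * \<rho> \<longrightarrow> P \<sigma>"
    by (elim exE conjE) (rule that)
  have "\<not> fits \<T> A x r (\<phi> / 4)" if r: "0 < r" "r \<le> R" for r
  proof
    assume "fits \<T> A x r (\<phi> / 4)"
    define r1 where "r1 = t / 4 * r"
    have fit1: "fits \<T> A x r1 (3 * \<delta> / 4)"
      unfolding r1_def using \<open>fits \<T> A x r (\<phi> / 4)\<close> r x R(1) by (intro step) auto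
    have "t * r \<le> r" using t r by simp
    then have "r1 \<le> R" unfolding r1_def using r by linarith
    then have r1: "0 < r1" "r1 \<le> R" using t r by (auto simp: r1_def)
    define r2 where "r2 = t / 4 * (r1 / 2)"
    have "t * r1 \<le> r1" using t r1 by simp
    then have "r2 \<le> R" unfolding r2_def using r1 by linarith
    then have r2: "0 < r2" "r2 \<le> R" using t r1 by (auto simp: r2_def)
    \<comment> \<open>The last entry limits the cost of moving the centre, so that the tolerance becomes at most \<open>2\<delta>\<close>.\<close>
    define \<eta> where "\<eta> = min (min (\<kappa> * r2) R) (min (r1 / 2) (\<delta> / 4 * r1))"
    have \<eta>: "0 < \<eta>" "\<eta> \<le> R" "\<eta> \<le> \<kappa> * r2" "\<eta> \<le> r1 / 2" "\<eta> \<le> \<delta> / 4 * r1"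
      using \<kappa> r1 r2 R \<open>\<delta> > 0\<close> by (auto simp: \<eta>_def)
    have "uniformly_approximable_near \<delta> \<T> A x"
    proof (rule uniformly_approximable_nearI[OF \<open>\<eta> > 0\<close>])
      fix y \<sigma> assume y: "y \<in> A" "dist x y < \<eta>" and \<sigma>: "0 < \<sigma>" "\<sigma> \<le> \<eta>"
      have yR: "y \<in> A \<inter> ball x R" using y \<eta>(2) by auto
      have "fits \<T> A y (r1 / 2) (2 * (3 * \<delta> / 4 + \<delta> / 4))"
        using fit1 r1(1) y \<eta> by (intro fits_nearby_centre) auto
      then have "fits \<T> A y (r1 / 2) (\<phi> / 4)"
        by (rule fits_mono) (use \<delta> \<open>\<delta> > 0\<close> r1 in auto)
      then have "fits \<T> A y r2 (3 * \<delta> / 4)"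
        unfolding r2_def using r1 by (intro step yR) auto
      then have "fits \<T> A y r2 \<delta>" by (rule fits_mono) (use \<open>\<delta> > 0\<close> r2 in auto)
      then have "fits \<T> A y \<sigma> \<delta>"
      proof (rule cover[rule_format, where P = "\<lambda>s. fits \<T> A y s \<delta>"])
        fix \<sigma> s :: real
        assume fit: "fits \<T> A y \<sigma> \<delta>" and "0 < \<sigma>" "\<sigma> \<le> r2" and s: "1/4 \<le> s" "s \<le> 1"
        have "s * \<sigma> \<le> \<sigma>" using s \<open>0 < \<sigma>\<close> by simp
        then have "s * \<sigma> \<le> R" using \<open>\<sigma> \<le> r2\<close> r2(2) by linarith
        have "fits \<T> A y (s * \<sigma>) (\<delta> / s)"
          using fit s \<open>0 < \<sigma>\<close> by (intro fits_smaller_radius) auto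
        moreover have "\<delta> / s \<le> \<phi> / 4"
        proof -
          have "\<delta> / s \<le> \<delta> / (1/4)" using s \<open>\<delta> > 0\<close> by (intro divide_left_mono) auto
          also have "\<dots> \<le> \<phi> / 4" using \<delta> \<open>\<delta> > 0\<close> by simp
          finally show ?thesis .
        qed
        ultimately have "fits \<T> A y (s * \<sigma>) (\<phi> / 4)"
          by (rule fits_mono) (use s \<open>0 < \<sigma>\<close> in auto)
        then have "fits \<T> A y (t / 4 * (s * \<sigma>)) (3 * \<delta> / 4)"
          using s \<open>0 < \<sigma>\<close> \<open>s * \<sigma> \<le> R\<close> by (intro step yR) auto
        then show "fits \<T> A y (t / 4 * s * \<sigma>) \<delta>"
          using \<open>\<delta> > 0\<close> s t \<open>0 < \<sigma>\<close> by (auto simp: mult.assoc elim!: fits_mono)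
      qed (use \<sigma> \<eta>(3) in auto)
      then show "approximability \<T> A y \<sigma> \<le> ennreal \<delta>"
        using \<sigma> \<open>\<delta> > 0\<close> by (intro fits_imp_approximability_le) auto
    qed
    then show False using bad by blast
  qed
  then show thesis using that R(1) by blast
qed

text \<open>
  Closeness to a member of the enlargement is turned into closeness of \<open>A\<close> to \<open>\<T>\<close> by two triangle
  inequalities, each of which doubles the tolerance.  As \<open>\<delta> \<le> \<phi>/32 = 4\<phi>/128\<close>, the total is
  \<open>2(4 + 2(1 + 5)) \<phi>/128 = \<phi>/4\<close>: here \<open>1\<close> stands for the distance from \<open>D\<close> to the enlargement,
  \<open>5 > 4\<close> for the one from there to \<open>\<T>\<close> and \<open>4\<close> for the one from the blow-ups of \<open>A\<close> to \<open>D\<close>.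
\<close>

lemma tangent_sets_subset_singular_class:
  assumes \<T>: "local_approx_class \<T>" and \<delta>: "0 \<le> \<delta>" "\<delta> \<le> \<phi> / 32" and "\<phi> > 0" and x: "x \<in> A"
    and R: "R > 0" "\<And>r. 0 < r \<Longrightarrow> r \<le> R \<Longrightarrow> \<not> fits \<T> A x r (\<phi> / 4)"
  shows "tangent_sets (closure A) x \<subseteq> singular_class (enlargement \<T> \<delta>)"
proof
  fix D assume D: "D \<in> tangent_sets (closure A) x"
  then obtain \<rho> where pos: "\<forall>i. \<rho> i > 0" and \<rho>: "\<rho> \<longlonglongrightarrow> 0"
    and lim: "\<forall>s>0. \<forall>e>0. \<forall>\<^sub>F i in sequentially. close_in 0 s e ((\<lambda>y. (y - x) /\<^sub>R \<rho> i) ` A) D"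
    by (rule tangent_setE)
  have D0: "D \<in> closed_through_0" using D by (simp add: tangent_sets_def)
  then have "0 \<in> D" by (simp add: closed_through_0_def)
  have "ennreal (\<phi> / 128) \<le> approximability (enlargement \<T> \<delta>) D 0 r" if "r > 0" for r
  proof (rule ccontr)
    assume "\<not> ?thesis"
    then have "fits (enlargement \<T> \<delta>) D 0 r (\<phi> / 128)"
      using that by (intro approximability_less_imp_fits) auto
    then obtain E where E: "E \<in> enlargement \<T> \<delta>" and DE: "close_in 0 r (\<phi> / 128) D E"
      by (auto simp: fits_0)
    have "0 \<in> E" and "approximability \<T> E 0 r \<le> ennreal \<delta>"
      using E that by (auto simp: enlargement_def closed_through_0_def)
    then have "fits \<T> E 0 r (5 * \<phi> / 128)"
      using \<delta> \<open>\<phi> > 0\<close> that by (intro approximability_le_imp_fits[of _ _ _ _ \<delta>]) auto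
    then obtain T where T: "T \<in> \<T>" and ET: "close_in 0 r (5 * \<phi> / 128) E T" by (auto simp: fits_0)
    have DT: "close_in 0 (r / 2) (12 * \<phi> / 128) D T"
      using close_in_trans[OF DE ET \<open>0 \<in> E\<close> that] by (simp add: field_simps)
    have "\<forall>\<^sub>F i in sequentially. close_in 0 (r / 2) (4 * \<phi> / 128) ((\<lambda>y. (y - x) /\<^sub>R \<rho> i) ` A) D"
      using that \<open>\<phi> > 0\<close> by (intro lim[rule_format]) auto
    moreover have "\<forall>\<^sub>F i in sequentially. \<rho> i < R / (r / 4)"
      using \<rho> R(1) that by (intro order_tendstoD(2)) auto
    ultimately have "\<forall>\<^sub>F i in sequentially. False"
    proof eventually_elim
      case (elim i)
      have "close_in 0 (r / 2 / 2) (2 * (4 * \<phi> / 128 + 12 * \<phi> / 128)) ((\<lambda>y. (y - x) /\<^sub>R \<rho> i) ` A) T"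
        using elim(1) DT \<open>0 \<in> D\<close> that by (intro close_in_trans) auto
      then have "fits \<T> ((\<lambda>y. (y - x) /\<^sub>R \<rho> i) ` A) 0 (r / 4) (\<phi> / 4)"
        using T by (auto simp: fits_0)
      then have "fits \<T> A x (\<rho> i * (r / 4)) (\<phi> / 4)" using fits_blow_up[OF \<T>] pos by blast
      moreover have "\<rho> i * (r / 4) \<le> R" using elim(2) that by (simp add: field_simps)
      ultimately show ?case using R(2) pos[rule_format, of i] that by auto
    qed
    then show False by simp
  qed
  then have "ennreal (\<phi> / 128) \<le> Liminf (at_right 0) (\<lambda>r. approximability (enlargement \<T> \<delta>) D 0 r)"
    by (intro Liminf_bounded) (auto simp: eventually_at_filter)
  moreover have "0 < ennreal (\<phi> / 128)" using \<open>\<phi> > 0\<close> by simp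
  ultimately have "0 < Liminf (at_right 0) (\<lambda>r. approximability (enlargement \<T> \<delta>) D 0 r)" by order
  then show "D \<in> singular_class (enlargement \<T> \<delta>)" using D0 by (simp add: singular_class_def)
qed

section \<open>The decomposition\<close>

theorem theorem6p6:
  fixes \<T> \<S> \<P> \<Q> :: "(real ^ 'n) set set"
    and A :: "(real ^ 'n) set"
    and \<phi> \<delta> t \<epsilon> :: real
    and \<Phi> :: "real \<Rightarrow> real"
  assumes "local_approx_class \<T>"
    and "local_approx_class \<S>"
    and "points_detectable \<T> \<phi> \<Phi> \<S>"
    and "\<delta> \<le> \<phi> / 32"
    and "t \<in> {0<..<1}"
    and "\<Phi> t \<le> \<delta> / 4"
    and "0 \<le> \<epsilon>"
    and "\<epsilon> < t * \<delta> / 16"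
    and "\<P> = enlargement \<S> \<epsilon>"
    and "\<Q> = enlargement \<T> \<delta>"
    and "A \<noteq> {}"
    and "locally_approximable \<epsilon> \<S> A"
  shows "\<exists>A\<^sub>Q A\<^sub>Q\<^sub>p.
    A = A\<^sub>Q \<union> A\<^sub>Q\<^sub>p \<and> A\<^sub>Q \<inter> A\<^sub>Q\<^sub>p = {} \<and>
    (\<forall>x\<in>A\<^sub>Q. pseudotangent_sets (closure A) x \<subseteq> \<P> \<inter> \<Q>) \<and>
    (\<forall>x\<in>A\<^sub>Q\<^sub>p. tangent_sets (closure A) x \<subseteq> \<P> \<inter> singular_class \<Q>) \<and>
    openin (top_of_set A) A\<^sub>Q \<and>
    locally_approximable \<delta> \<T> A\<^sub>Q"
proof -
  note \<T> = assms(1) and \<S> = assms(2) and det = assms(3) and \<P> = assms(9) and \<Q> = assms(10)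
  have sub: "\<T> \<subseteq> closed_through_0" "\<S> \<subseteq> closed_through_0"
    using \<T> \<S> by (auto simp: local_approx_class_def)
  have \<phi>: "\<phi> > 0" and "\<Phi> t > 0"
    using det assms(5) by (auto simp: points_detectable_def)
  then have \<delta>: "\<delta> \<ge> 0" using assms(6) by simp
  define G where "G = {x \<in> A. uniformly_approximable_near \<delta> \<T> A x}"
  have unif: "uniformly_approximable_near \<epsilon> \<S> A x" if "x \<in> A" for x
    using assms(12) that by (rule locally_approximable_imp_uniform)
  have P: "pseudotangent_sets (closure A) x \<subseteq> \<P>" if "x \<in> A" for x
    unfolding \<P> by (rule pseudotangent_sets_subset_enlargement[OF \<S> assms(7) unif[OF that]])
  have Q: "pseudotangent_sets (closure A) x \<subseteq> \<Q>" if "x \<in> G" for x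
    unfolding \<Q> using that
    by (intro pseudotangent_sets_subset_enlargement[OF \<T> \<delta>]) (simp add: G_def)
  have perp: "tangent_sets (closure A) x \<subseteq> singular_class \<Q>" if x: "x \<in> A - G" for x
  proof -
    obtain R where "R > 0" "\<And>r. 0 < r \<Longrightarrow> r \<le> R \<Longrightarrow> \<not> fits \<T> A x r (\<phi> / 4)"
      using not_uniform_imp_not_fits[OF sub det assms(4-8) _ unif] x by (auto simp: G_def)
    then show ?thesis
      unfolding \<Q> using x by (intro tangent_sets_subset_singular_class[OF \<T> \<delta> assms(4) \<phi>]) auto
  qed
  have tan: "tangent_sets (closure A) x \<subseteq> pseudotangent_sets (closure A) x" if "x \<in> A" for x
    using that closure_subset by (intro tangent_sets_subset_pseudotangent_sets) blast
  show ?thesis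
  proof (rule exI[of _ G], rule exI[of _ "A - G"], intro conjI ballI)
    show "A = G \<union> (A - G)" by (auto simp: G_def)
    show "pseudotangent_sets (closure A) x \<subseteq> \<P> \<inter> \<Q>" if "x \<in> G" for x
      using P Q that by (auto simp: G_def)
    show "tangent_sets (closure A) x \<subseteq> \<P> \<inter> singular_class \<Q>" if "x \<in> A - G" for x
      using P[of x] tan[of x] perp[OF that] that by blast
    show "openin (top_of_set A) G"
      unfolding G_def by (rule openin_uniformly_approximable)
    show "locally_approximable \<delta> \<T> G"
      unfolding G_def by (rule locally_approximable_uniformly_approximable[OF \<delta>])
  qed auto
qed

end
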